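(* Each of the four classes of abelian groups $\mathcal{H}$ (Hopfian), $\mathcal{RH}$ (relatively Hopfian), $\mathcal{WH}$ (weakly Hopfian) and $\mathcal{DF}$ (directly finite) is closed under direct summands: if $G$ is an abelian group belonging to one of these classes and $K$ is a direct summand of $G$, then $K$ belongs to the same class.
   Context: All groups are abelian, written additively. A group $G$ is Hopfian if every surjective endomorphism of $G$ is injective. $G$ is relatively Hopfian if, for every group $A$, the existence of a surjective homomorphism $G\to G\oplus A$ implies $A=\{0\}$. $G$ is weakly Hopfian if every surjective endomorphism $G\to G$ whose kernel is a pure subgroup of $G$ has zero kernel. $G$ is directly finite if $G$ is not isomorphic to a proper direct summand of itself, i.e. $G\cong G\oplus A$ implies $A=\{0\}$. A subgroup $J\le G$ is pure if $nG\cap J=nJ$ for all positive integers $n$. *)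

theory Defs
  imports "HOL-Algebra.Elementary_Groups"
begin

text \<open>
  Abelian groups are rendered by \<^locale>\<open>comm_group\<close>, which is written multiplicatively:
  \<open>n x\<close> becomes \<open>x [^] n\<close>, \<open>0\<close> becomes \<open>\<one>\<close>, and \<open>G \<oplus> A\<close> becomes \<open>G \<times>\<times> A\<close>.
\<close>

definition pure_subgroup :: "'a set \<Rightarrow> ('a, 'b) monoid_scheme \<Rightarrow> bool" where
  "pure_subgroup J G \<longleftrightarrow> subgroup J G \<and>
     (\<forall>n::nat. n > 0 \<longrightarrow>
        (\<lambda>x. x [^]\<^bsub>G\<^esub> n) ` carrier G \<inter> J = (\<lambda>x. x [^]\<^bsub>G\<^esub> n) ` J)"

definition direct_summand :: "'a set \<Rightarrow> ('a, 'b) monoid_scheme \<Rightarrow> bool" where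
  "direct_summand K G \<longleftrightarrow> subgroup K G \<and>
     (\<exists>L. subgroup L G \<and> K \<inter> L = {\<one>\<^bsub>G\<^esub>} \<and> K <#>\<^bsub>G\<^esub> L = carrier G)"

definition hopfian :: "('a, 'b) monoid_scheme \<Rightarrow> bool" where
  "hopfian G \<longleftrightarrow> comm_group G \<and> (\<forall>f \<in> epi G G. inj_on f (carrier G))"

text \<open>
  A definition cannot quantify over all types, so in the next definition and in that of
  \<open>directly_finite\<close> the group \<open>A\<close> ranges over the groups on the element type of \<open>G\<close>. This loses
  nothing, because \<open>A\<close> is an image of \<open>G\<close> in both cases; see \<open>relatively_hopfian_any_type\<close> and
  \<open>directly_finite_any_type\<close>.
\<close>

definition relatively_hopfian :: "('a, 'b) monoid_scheme \<Rightarrow> bool" where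
  "relatively_hopfian G \<longleftrightarrow> comm_group G \<and>
     (\<forall>A :: 'a monoid. comm_group A \<longrightarrow> epi G (G \<times>\<times> A) \<noteq> {} \<longrightarrow> trivial_group A)"

definition weakly_hopfian :: "('a, 'b) monoid_scheme \<Rightarrow> bool" where
  "weakly_hopfian G \<longleftrightarrow> comm_group G \<and>
     (\<forall>f \<in> epi G G. pure_subgroup (kernel G G f) G \<longrightarrow> kernel G G f = {\<one>\<^bsub>G\<^esub>})"

definition directly_finite :: "('a, 'b) monoid_scheme \<Rightarrow> bool" where
  "directly_finite G \<longleftrightarrow> comm_group G \<and>
     (\<forall>A :: 'a monoid. comm_group A \<longrightarrow> G \<cong> G \<times>\<times> A \<longrightarrow> trivial_group A)"

lemma epi_image_copy:
  fixes G :: "('a, 'b) monoid_scheme" and A :: "('c, 'd) monoid_scheme"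
  assumes G: "comm_group G" and A: "comm_group A" and f: "f \<in> epi G (G \<times>\<times> A)"
  obtains B :: "'a monoid" where "comm_group B" "A \<cong> B"
proof -
  interpret G: comm_group G by fact
  interpret A: comm_group A by fact
  define h where "h = snd \<circ> f"
  have "h ` carrier G = snd ` (carrier G \<times> carrier A)"
    using f by (simp add: epi_def h_def flip: image_image)
  also have "\<dots> = carrier A"
    using G.one_closed by force
  finally have surj: "h ` carrier G = carrier A" .
  define s where "s = inv_into (carrier G) h"
  have hs: "h (s x) = x" if "x \<in> carrier A" for x
    using that surj by (simp add: s_def f_inv_into_f)
  define B where "B = \<lparr>carrier = s ` carrier A,
    monoid.mult = (\<lambda>x y. s (h x \<otimes>\<^bsub>A\<^esub> h y)), one = s \<one>\<^bsub>A\<^esub>\<rparr>"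
  have "inj_on s (carrier A)"
    by (metis hs inj_on_inverseI)
  then have s: "s \<in> iso A B"
    by (auto simp: iso_def hom_def bij_betw_def B_def hs)
  have "B\<lparr>one := s \<one>\<^bsub>A\<^esub>\<rparr> = B"
    by (simp add: B_def)
  with A.iso_imp_img_comm_group [OF s] have "comm_group B"
    by simp
  then show thesis
    using s that by (auto simp: is_iso_def)
qed

lemma relatively_hopfian_any_type:
  fixes G :: "('a, 'b) monoid_scheme" and A :: "('c, 'd) monoid_scheme"
  assumes G: "relatively_hopfian G" and A: "comm_group A" and ne: "epi G (G \<times>\<times> A) \<noteq> {}"
  shows "trivial_group A"
proof -
  have cG: "comm_group G" using G by (simp add: relatively_hopfian_def)
  interpret G: comm_group G by fact
  obtain f where f: "f \<in> epi G (G \<times>\<times> A)" using ne by blast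
  obtain B :: "'a monoid" where B: "comm_group B" and AB: "A \<cong> B"
    using epi_image_copy [OF cG A f] .
  obtain g where "g \<in> iso (G \<times>\<times> A) (G \<times>\<times> B)"
    using G.DirProd_iso_trans [OF iso_refl AB] by (auto simp: is_iso_def)
  then have "g \<circ> f \<in> epi G (G \<times>\<times> B)"
    using f by (auto simp: iso_iff_mon_epi intro: epi_compose)
  then have "trivial_group B"
    using G B by (auto simp: relatively_hopfian_def)
  then show ?thesis
    using isomorphic_group_triviality [OF AB] A B by (simp add: comm_group_def)
qed

lemma directly_finite_any_type:
  fixes G :: "('a, 'b) monoid_scheme" and A :: "('c, 'd) monoid_scheme"
  assumes G: "directly_finite G" and A: "comm_group A" and GA: "G \<cong> G \<times>\<times> A"
  shows "trivial_group A"
proof -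
  have cG: "comm_group G" using G by (simp add: directly_finite_def)
  interpret G: comm_group G by fact
  obtain f where f: "f \<in> epi G (G \<times>\<times> A)"
    using GA by (auto simp: is_iso_def iso_iff_mon_epi)
  obtain B :: "'a monoid" where B: "comm_group B" and AB: "A \<cong> B"
    using epi_image_copy [OF cG A f] .
  have "G \<cong> G \<times>\<times> B"
    using GA G.DirProd_iso_trans [OF iso_refl AB] iso_trans by blast
  then have "trivial_group B"
    using G B by (auto simp: directly_finite_def)
  then show ?thesis
    using isomorphic_group_triviality [OF AB] A B by (simp add: comm_group_def)
qed

end

theory Submission
  imports Defs
begin

text \<open>
  Write \<open>G = K \<oplus> L\<close>. A homomorphism \<open>f\<close> defined on \<open>K\<close> extends to \<open>G\<close> by letting it act as the
  identity on \<open>L\<close>; the extension is surjective, or bijective, when \<open>f\<close> is, and its kernel is that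
  of \<open>f\<close>. So a map on \<open>K\<close> that violates one of the four properties becomes a map on \<open>G\<close> that
  violates the same property.

  For a surjection \<open>f : K \<rightarrow> K\<close> the extension is a surjection \<open>G \<rightarrow> G\<close> with the same kernel
  (\<open>epi_extension\<close>). This settles the Hopfian property at once, and the weak one because a
  subgroup that is pure in \<open>K\<close> is pure in \<open>G\<close> (\<open>pure_in_summand_imp_pure\<close>). For a map
  \<open>K \<rightarrow> K \<oplus> A\<close> the extension is a map \<open>K \<oplus> L \<rightarrow> (K \<oplus> A) \<oplus> L\<close>, and
  \<open>(K \<oplus> A) \<oplus> L \<cong> (K \<oplus> L) \<oplus> A \<cong> G \<oplus> A\<close> (\<open>iso_absorb_complement\<close>), with the same group \<open>A\<close>.
  This settles the other two properties.
\<close>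

lemma (in comm_group) subgroup_imp_comm_group:
  assumes "subgroup H G"
  shows "comm_group (G\<lparr>carrier := H\<rparr>)"
  using subgroup_imp_group [OF assms] subgroup.mem_carrier [OF assms]
  by (auto intro!: group.group_comm_groupI simp: m_comm)

locale internal_direct_sum = comm_group G for G (structure) +
  fixes K L
  assumes K: "subgroup K G" and L: "subgroup L G"
    and disjoint: "K \<inter> L = {\<one>}" and span: "K <#> L = carrier G"
begin

abbreviation "GK \<equiv> G\<lparr>carrier := K\<rparr>"
abbreviation "GL \<equiv> G\<lparr>carrier := L\<rparr>"

sublocale group_disjoint_sum G K L
  by (intro group_disjoint_sum.intro is_group K L)

sublocale GK: comm_group GK
  using K by (rule subgroup_imp_comm_group)

sublocale GL: comm_group GL
  using L by (rule subgroup_imp_comm_group)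

lemma mult_eq_one_iff:
  assumes "x \<in> K" "y \<in> L"
  shows "x \<otimes> y = \<one> \<longleftrightarrow> x = \<one> \<and> y = \<one>"
  using assms sub_id_iff disjoint by auto

lemma decompose:
  assumes "x \<in> carrier G"
  obtains k l where "k \<in> K" "l \<in> L" "x = k \<otimes> l"
proof -
  have "x \<in> K <#> L"
    using assms span by simp
  then show thesis
    using that by (auto simp: set_mult_def)
qed

lemma mult_iso: "(\<lambda>(x, y). x \<otimes> y) \<in> iso (GK \<times>\<times> GL) G"
proof -
  have "inj_on (\<lambda>(x, y). x \<otimes> y) (K \<times> L)"
    using cancel disjoint by (auto simp: inj_on_def)
  moreover have "(\<lambda>(x, y). x \<otimes> y) ` (K \<times> L) = carrier G"
    unfolding span [symmetric] by (auto simp: set_mult_def)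
  moreover have "(\<lambda>(x, y). x \<otimes> y) \<in> hom (GK \<times>\<times> GL) G"
    by (auto simp: hom_def AG.mem_carrier BG.mem_carrier m_ac)
  ultimately show ?thesis
    by (simp add: iso_def bij_betw_def)
qed

text \<open>
  \<open>A\<close> is carried over unchanged when \<open>K \<oplus> A\<close> is completed by \<open>L\<close>, so its triviality can be
  read off from \<open>G\<close>.
\<close>

lemma iso_absorb_complement:
  fixes A :: "('c, 'd) monoid_scheme"
  assumes "comm_group A"
  shows "(GK \<times>\<times> A) \<times>\<times> GL \<cong> G \<times>\<times> A"
proof -
  interpret A: comm_group A by fact
  have "(\<lambda>((x, a), y). (x \<otimes> y, a)) \<in> hom ((GK \<times>\<times> A) \<times>\<times> GL) (G \<times>\<times> A)"
    by (auto simp: hom_def AG.mem_carrier BG.mem_carrier m_ac)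
  moreover have "inj_on (\<lambda>((x, a), y). (x \<otimes> y, a)) ((K \<times> carrier A) \<times> L)"
    using cancel disjoint by (auto simp: inj_on_def)
  moreover have "(\<lambda>((x, a), y). (x \<otimes> y, a)) ` ((K \<times> carrier A) \<times> L) = carrier G \<times> carrier A"
    unfolding span [symmetric] by (force simp: set_mult_def)
  ultimately have "(\<lambda>((x, a), y). (x \<otimes> y, a)) \<in> iso ((GK \<times>\<times> A) \<times>\<times> GL) (G \<times>\<times> A)"
    by (simp add: iso_def bij_betw_def)
  then show ?thesis
    by (auto simp: is_iso_def)
qed

lemma iso_external: "G \<cong> GK \<times>\<times> GL"
proof (rule group.iso_sym)
  show "GK \<times>\<times> GL \<cong> G"
    using mult_iso by (rule is_isoI)
qed (rule DirProd_group [OF GK.is_group GL.is_group])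

lemma epi_times_id:
  assumes "f \<in> epi GK H"
  shows "(\<lambda>(x, y). (f x, y)) \<in> epi (GK \<times>\<times> GL) (H \<times>\<times> GL)"
  using assms iso_set_refl [of GL]
  by (simp add: epi_def iso_def hom_paired2 image_paired_Times GK.is_group GL.is_group)

text \<open>
  The extension sends \<open>k \<otimes> l\<close> to \<open>f k \<otimes> l\<close>. Its kernel is no larger than that of \<open>f\<close> because
  \<open>f k\<close> and \<open>l\<close> lie in complementary subgroups.
\<close>

lemma epi_extension:
  assumes f: "f \<in> epi GK GK"
  obtains F where "F \<in> epi G G" "kernel G G F = kernel GK GK f"
proof -
  define h where "h = (\<lambda>(x, y). x \<otimes> y)"
  define u where "u = inv_into (carrier (GK \<times>\<times> GL)) h"
  define F where "F = h \<circ> ((\<lambda>(x, y). (f x, y)) \<circ> u)"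
  have h: "h \<in> iso (GK \<times>\<times> GL) G"
    unfolding h_def by (rule mult_iso)
  have u: "u \<in> iso G (GK \<times>\<times> GL)"
    unfolding u_def
    by (rule group.iso_set_sym [OF DirProd_group [OF GK.is_group GL.is_group] h])
  have fK: "f k \<in> K" if "k \<in> K" for k
    using f that by (auto simp: epi_def hom_def)
  have f1: "f \<one> = \<one>"
    using f hom_one [of f GK GK] GK.is_group by (simp add: epi_def)
  have F: "F (k \<otimes> l) = f k \<otimes> l" if "k \<in> K" "l \<in> L" for k l
  proof -
    have "u (h (k, l)) = (k, l)"
      using h that unfolding u_def iso_def bij_betw_def by (intro inv_into_f_f) auto
    then show ?thesis
      by (simp add: F_def h_def)
  qed
  have "F \<in> epi G G"
    unfolding F_def using h u epi_times_id [OF f]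
    by (auto simp: iso_iff_mon_epi intro!: epi_compose)
  moreover have "kernel G G F = kernel GK GK f"
  proof (intro equalityI subsetI)
    fix x assume "x \<in> kernel G G F"
    then obtain k l where "k \<in> K" "l \<in> L" "x = k \<otimes> l" "F x = \<one>"
      by (auto simp: kernel_def elim: decompose)
    then show "x \<in> kernel GK GK f"
      by (simp add: F fK mult_eq_one_iff kernel_def AG.mem_carrier)
  next
    fix x assume "x \<in> kernel GK GK f"
    then have "x \<in> K" "f x = \<one>"
      by (auto simp: kernel_def)
    then show "x \<in> kernel G G F"
      using F [of x \<one>] by (simp add: kernel_def AG.mem_carrier)
  qed
  ultimately show thesis ..
qed

text \<open>
  If \<open>(k \<otimes> l) [^] n\<close> lies in \<open>K\<close>, then \<open>l [^] n\<close> lies in \<open>K \<inter> L\<close> and so is trivial: an \<open>n\<close>-th root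
  in \<open>G\<close> of an element of \<open>K\<close> can be replaced by its component in \<open>K\<close>. Hence \<open>K\<close> is pure in \<open>G\<close>,
  and purity is transitive.
\<close>

lemma pure_in_summand_imp_pure:
  assumes "pure_subgroup J GK"
  shows "pure_subgroup J G"
proof -
  have J: "subgroup J GK"
    and eq: "\<And>n. n > 0 \<Longrightarrow> (\<lambda>x. x [^] (n::nat)) ` K \<inter> J = (\<lambda>x. x [^] n) ` J"
    using assms by (auto simp: pure_subgroup_def nat_pow_consistent [symmetric])
  have JK: "J \<subseteq> K"
    using subgroup.subset [OF J] by simp
  have root: "k [^] n = (k \<otimes> l) [^] n" if "k \<in> K" "l \<in> L" "(k \<otimes> l) [^] n \<in> K" for k l and n :: nat
  proof -
    have kl: "k [^] n \<in> K" "l [^] n \<in> L"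
      using that GK.nat_pow_closed [of k n] GL.nat_pow_closed [of l n]
      by (simp_all add: nat_pow_consistent [symmetric])
    have pow: "(k \<otimes> l) [^] n = k [^] n \<otimes> l [^] n"
      using that by (simp add: AG.mem_carrier BG.mem_carrier nat_pow_distrib)
    have "k [^] n = (k \<otimes> l) [^] n \<and> l [^] n = \<one>"
      using cancel disjoint kl that pow AG.mem_carrier BG.one_closed
      by (metis nat_pow_closed order_refl r_one)
    then show ?thesis ..
  qed
  have "(\<lambda>x. x [^] n) ` carrier G \<inter> J = (\<lambda>x. x [^] n) ` J" if "n > 0" for n :: nat
  proof -
    have "(\<lambda>x. x [^] n) ` carrier G \<inter> J = (\<lambda>x. x [^] n) ` K \<inter> J"
    proof (intro equalityI subsetI)
      fix x assume x: "x \<in> (\<lambda>x. x [^] n) ` carrier G \<inter> J"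
      then obtain k l where kl: "k \<in> K" "l \<in> L" "x = (k \<otimes> l) [^] n"
        by (auto elim: decompose)
      then have "x = k [^] n"
        using root [of k l n] x JK by auto
      then show "x \<in> (\<lambda>x. x [^] n) ` K \<inter> J"
        using kl(1) x by blast
    qed (use AG.subset in auto)
    then show ?thesis
      using eq that by simp
  qed
  moreover have "subgroup J G"
    using incl_subgroup [OF K J] .
  ultimately show ?thesis
    by (simp add: pure_subgroup_def)
qed

lemma hopfian_summand:
  assumes "hopfian G"
  shows "hopfian GK"
  unfolding hopfian_def
proof (intro conjI ballI GK.comm_group_axioms)
  fix f assume f: "f \<in> epi GK GK"
  then obtain F where F: "F \<in> epi G G" and ker: "kernel G G F = kernel GK GK f"
    by (rule epi_extension)
  interpret F: group_hom G G F
    using F by unfold_locales (simp add: epi_def)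
  interpret f: group_hom GK GK f
    using f by unfold_locales (simp add: epi_def)
  show "inj_on f (carrier GK)"
    using assms F ker F.inj_iff_trivial_ker f.inj_iff_trivial_ker by (simp add: hopfian_def)
qed

lemma weakly_hopfian_summand:
  assumes "weakly_hopfian G"
  shows "weakly_hopfian GK"
  unfolding weakly_hopfian_def
proof (intro conjI ballI impI GK.comm_group_axioms)
  fix f assume f: "f \<in> epi GK GK" and pure: "pure_subgroup (kernel GK GK f) GK"
  obtain F where "F \<in> epi G G" "kernel G G F = kernel GK GK f"
    using f by (rule epi_extension)
  then show "kernel GK GK f = {\<one>\<^bsub>GK\<^esub>}"
    using assms pure_in_summand_imp_pure [OF pure] by (auto simp: weakly_hopfian_def)
qed

lemma relatively_hopfian_summand:
  assumes "relatively_hopfian G"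
  shows "relatively_hopfian GK"
  unfolding relatively_hopfian_def
proof (intro conjI allI impI GK.comm_group_axioms)
  fix A :: "'a monoid"
  assume A: "comm_group A" and "epi GK (GK \<times>\<times> A) \<noteq> {}"
  then obtain f where f: "f \<in> epi GK (GK \<times>\<times> A)"
    by blast
  obtain u where u: "u \<in> epi G (GK \<times>\<times> GL)"
    using iso_external by (auto simp: is_iso_def iso_iff_mon_epi)
  obtain v where v: "v \<in> epi ((GK \<times>\<times> A) \<times>\<times> GL) (G \<times>\<times> A)"
    using iso_absorb_complement [OF A] by (auto simp: is_iso_def iso_iff_mon_epi)
  have "v \<circ> ((\<lambda>(x, y). (f x, y)) \<circ> u) \<in> epi G (G \<times>\<times> A)"
    by (rule epi_compose [OF epi_compose [OF u epi_times_id [OF f]] v])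
  then show "trivial_group A"
    using assms A by (auto simp: relatively_hopfian_def)
qed

lemma directly_finite_summand:
  assumes "directly_finite G"
  shows "directly_finite GK"
  unfolding directly_finite_def
proof (intro conjI allI impI GK.comm_group_axioms)
  fix A :: "'a monoid"
  assume A: "comm_group A" and iso: "GK \<cong> GK \<times>\<times> A"
  have "GK \<times>\<times> GL \<cong> (GK \<times>\<times> A) \<times>\<times> GL"
    by (intro GK.DirProd_iso_trans iso iso_refl)
  then have "G \<cong> G \<times>\<times> A"
    by (rule iso_trans [OF iso_trans [OF iso_external] iso_absorb_complement [OF A]])
  then show "trivial_group A"
    using assms A by (simp add: directly_finite_def)
qed

end

theorem proposition2p1:
  fixes G :: "('a, 'b) monoid_scheme" and K :: "'a set"
  assumes "comm_group G" and "direct_summand K G"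
  shows "(hopfian G \<longrightarrow> hopfian (G\<lparr>carrier := K\<rparr>)) \<and>
         (relatively_hopfian G \<longrightarrow> relatively_hopfian (G\<lparr>carrier := K\<rparr>)) \<and>
         (weakly_hopfian G \<longrightarrow> weakly_hopfian (G\<lparr>carrier := K\<rparr>)) \<and>
         (directly_finite G \<longrightarrow> directly_finite (G\<lparr>carrier := K\<rparr>))"
proof -
  obtain L where "subgroup K G" "subgroup L G" "K \<inter> L = {\<one>\<^bsub>G\<^esub>}" "K <#>\<^bsub>G\<^esub> L = carrier G"
    using assms(2) by (auto simp: direct_summand_def)
  then interpret internal_direct_sum G K L
    using assms(1) by (intro internal_direct_sum.intro internal_direct_sum_axioms.intro)
  show ?thesis
    using hopfian_summand relatively_hopfian_summand weakly_hopfian_summand directly_finite_summand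
    by blast
qed

end
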